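(* Let $G$ and $H$ be finite groups, $X$ a finite $G$-set with $|X|=v$, and $f:X\to H$ a function whose image consists of exactly two elements $h_1,h_2\in H$. Let $k_i:=|f^{-1}(h_i)|$ for $i=1,2$. Then $f$ is $G$-perfect nonlinear if and only if one of the following holds: (i) $|H|=2$, $4\mid v$, and $f^{-1}(h_1)$ is a $G$--$(v,k_1,k_1-v/4)$ difference set (equivalently, $f^{-1}(h_2)$ is a $G$--$(v,k_2,k_2-v/4)$ difference set); (ii) $|H|=3$, $3\mid v$, and $f^{-1}(h_1)$ is a $G$--$(v,k_1,k_1-v/3)$ difference set (equivalently, $f^{-1}(h_2)$ is a $G$--$(v,k_2,k_2-v/3)$ difference set).
   Context: $X$ is a $G$-set (a set with an action $(\alpha,x)\mapsto\alpha x$ of $G$). $f:X\to H$ is $G$-perfect nonlinear if $|H|$ divides $|X|$ and for all $\alpha\in G\setminus\{1_G\}$ and $\sigma\in H$, $|\{x\in X: f(\alpha x)f(x)^{-1}=\sigma\}|=|X|/|H|$. A subset $D\subseteq X$ with $|D|=k$ is a $G$--$(v,k,\ell)$ difference set ($v=|X|$) if for every $\alpha\in G\setminus\{1_G\}$ there are exactly $\ell$ pairs $(x_1,x_2)\in D\times D$ with $\alpha x_1=x_2$.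
   Formalization: The group G is additionally assumed nontrivial; for trivial G the conditions over α ≠ 1 are vacuous and the claim fails, e.g. for H = Z/2, X = H, f = id, where f is perfect nonlinear with v = 2 but 4 does not divide v and |H| is not 3. *)

theory Defs
  imports "HOL-Algebra.Group_Action"
begin

definition perfect_nonlinear ::
  "('a, 'm) monoid_scheme \<Rightarrow> 'x set \<Rightarrow> ('a \<Rightarrow> 'x \<Rightarrow> 'x) \<Rightarrow>
   ('b, 'n) monoid_scheme \<Rightarrow> ('x \<Rightarrow> 'b) \<Rightarrow> bool"
where
  "perfect_nonlinear G X \<phi> H f \<longleftrightarrow>
     order H dvd card X \<and>
     (\<forall>\<alpha> \<in> carrier G - {\<one>\<^bsub>G\<^esub>}. \<forall>\<sigma> \<in> carrier H.
        card {x \<in> X. f (\<phi> \<alpha> x) \<otimes>\<^bsub>H\<^esub> inv\<^bsub>H\<^esub> (f x) = \<sigma>} = card X div order H)"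

text \<open>
  The parameter \<open>l\<close> is an integer, so that a difference such as \<open>k - v/4\<close> can be used
  for it without truncation; for negative \<open>l\<close> and nontrivial \<open>G\<close> the predicate is false.
\<close>

definition difference_set ::
  "('a, 'm) monoid_scheme \<Rightarrow> 'x set \<Rightarrow> ('a \<Rightarrow> 'x \<Rightarrow> 'x) \<Rightarrow>
   nat \<Rightarrow> nat \<Rightarrow> int \<Rightarrow> 'x set \<Rightarrow> bool"
where
  "difference_set G X \<phi> v k l D \<longleftrightarrow>
     D \<subseteq> X \<and> card X = v \<and> card D = k \<and>
     (\<forall>\<alpha> \<in> carrier G - {\<one>\<^bsub>G\<^esub>}.
        int (card {(x\<^sub>1, x\<^sub>2) \<in> D \<times> D. \<phi> \<alpha> x\<^sub>1 = x\<^sub>2}) = l)"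

end

theory Submission
  imports Defs "HOL-Algebra.Multiplicative_Group"
begin

text \<open>
  Put \<open>D = f\<^sup>-\<^sup>1(h\<^sub>1)\<close> and \<open>s = h\<^sub>1 h\<^sub>2\<^sup>-\<^sup>1\<close>. For \<open>\<alpha> \<noteq> 1\<close> let \<open>m\<close> be the number of points
  outside \<open>D\<close> that \<open>\<alpha>\<close> moves into \<open>D\<close>. Since \<open>\<alpha>\<close> permutes \<open>X\<close>, it also moves exactly \<open>m\<close> points
  out of \<open>D\<close>, and it keeps \<open>|D| - m\<close> points in \<open>D\<close>; so being a difference set with parameter
  \<open>|D| - c\<close> means \<open>m = c\<close> for all \<open>\<alpha>\<close>, a condition symmetric in \<open>D\<close> and its complement.
  The quotient \<open>f(\<alpha>x) f(x)\<^sup>-\<^sup>1\<close> takes only the values \<open>s\<close> (\<open>m\<close> times), \<open>s\<^sup>-\<^sup>1\<close> (\<open>m\<close> times) and \<open>1\<close>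
  (\<open>v - 2m\<close> times). Perfect nonlinearity makes all elements of \<open>H\<close> occur, so \<open>|H| \<le> 3\<close>.
  If \<open>|H| = 2\<close> then \<open>s = s\<^sup>-\<^sup>1\<close> and the condition is \<open>2m = v/2\<close>; if \<open>|H| = 3\<close> it is \<open>m = v/3\<close>.
\<close>

section \<open>Points that a group element moves into or out of a subset\<close>

context group_action
begin

lemma card_preimage:
  assumes "\<alpha> \<in> carrier G" "D \<subseteq> E"
  shows "card {x \<in> E. \<phi> \<alpha> x \<in> D} = card D"
proof -
  have inj: "inj_on (\<phi> \<alpha>) E" and surj: "\<phi> \<alpha> ` E = E"
    using inj_prop surj_prop assms(1) by auto
  have "\<phi> \<alpha> ` {x \<in> E. \<phi> \<alpha> x \<in> D} = D"
  proof
    show "D \<subseteq> \<phi> \<alpha> ` {x \<in> E. \<phi> \<alpha> x \<in> D}"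
    proof
      fix y assume "y \<in> D"
      then have "y \<in> \<phi> \<alpha> ` E" using surj assms(2) by auto
      then show "y \<in> \<phi> \<alpha> ` {x \<in> E. \<phi> \<alpha> x \<in> D}" using \<open>y \<in> D\<close> by auto
    qed
  qed auto
  moreover have "inj_on (\<phi> \<alpha>) {x \<in> E. \<phi> \<alpha> x \<in> D}"
    using inj by (rule inj_on_subset) auto
  ultimately show ?thesis
    by (metis card_image)
qed

text \<open>Bijectivity makes the preimage of \<open>D\<close> as large as \<open>D\<close>; that
  preimage is sorted here by whether a point starts inside \<open>D\<close>.\<close>

lemma card_entering:
  assumes "\<alpha> \<in> carrier G" "D \<subseteq> E" "finite E"
  shows "card {x \<in> D. \<phi> \<alpha> x \<in> D} + card {x \<in> E - D. \<phi> \<alpha> x \<in> D} = card D"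
proof -
  have "{x \<in> E. \<phi> \<alpha> x \<in> D} = {x \<in> D. \<phi> \<alpha> x \<in> D} \<union> {x \<in> E - D. \<phi> \<alpha> x \<in> D}"
    using assms(2) by auto
  moreover have "finite D" using assms(2,3) by (rule finite_subset)
  ultimately show ?thesis
    using card_preimage[OF assms(1,2)] assms(3)
    by (simp add: card_Un_disjoint disjoint_iff)
qed

text \<open>Either count, added to the number of points kept in \<open>D\<close>, gives
  \<open>card D\<close>: for leaving points sort \<open>D\<close> by images, for entering points use
  \<open>card_entering\<close>.\<close>

lemma card_leaving_eq_card_entering:
  assumes "\<alpha> \<in> carrier G" "D \<subseteq> E" "finite E"
  shows "card {x \<in> D. \<phi> \<alpha> x \<in> E - D} = card {x \<in> E - D. \<phi> \<alpha> x \<in> D}"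
proof -
  have fin: "finite D" using assms(2,3) by (rule finite_subset)
  have "\<And>x. x \<in> D \<Longrightarrow> \<phi> \<alpha> x \<in> E"
    using surj_prop[OF assms(1)] assms(2) by blast
  then have "D = {x \<in> D. \<phi> \<alpha> x \<in> D} \<union> {x \<in> D. \<phi> \<alpha> x \<in> E - D}"
    by auto
  then have "card D = card {x \<in> D. \<phi> \<alpha> x \<in> D} + card {x \<in> D. \<phi> \<alpha> x \<in> E - D}"
    using fin card_Un_disjoint[of "{x \<in> D. \<phi> \<alpha> x \<in> D}" "{x \<in> D. \<phi> \<alpha> x \<in> E - D}"] by auto
  then show ?thesis
    using card_entering[OF assms] by simp
qed

text \<open>A counted pair is determined by its first entry, so the pairs correspond to the points
  kept in \<open>D\<close>. The integer parameter lets \<open>c\<close> be arbitrary, even above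
  \<open>card D\<close>.\<close>

lemma difference_set_iff_card_entering:
  assumes "D \<subseteq> E" "finite E"
  shows "difference_set G E \<phi> (card E) (card D) (int (card D) - int c) D \<longleftrightarrow>
    (\<forall>\<alpha> \<in> carrier G - {\<one>}. card {x \<in> E - D. \<phi> \<alpha> x \<in> D} = c)"
proof -
  have "int (card {(x\<^sub>1, x\<^sub>2) \<in> D \<times> D. \<phi> \<alpha> x\<^sub>1 = x\<^sub>2}) = int (card D) - int c \<longleftrightarrow>
      card {x \<in> E - D. \<phi> \<alpha> x \<in> D} = c" if "\<alpha> \<in> carrier G" for \<alpha>
  proof -
    have "{(x\<^sub>1, x\<^sub>2) \<in> D \<times> D. \<phi> \<alpha> x\<^sub>1 = x\<^sub>2} = (\<lambda>x. (x, \<phi> \<alpha> x)) ` {x \<in> D. \<phi> \<alpha> x \<in> D}"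
      by auto
    moreover have "inj_on (\<lambda>x. (x, \<phi> \<alpha> x)) {x \<in> D. \<phi> \<alpha> x \<in> D}"
      by (auto intro: inj_onI)
    ultimately have "card {(x\<^sub>1, x\<^sub>2) \<in> D \<times> D. \<phi> \<alpha> x\<^sub>1 = x\<^sub>2} = card {x \<in> D. \<phi> \<alpha> x \<in> D}"
      by (simp add: card_image)
    then show ?thesis
      using card_entering[OF that assms] by linarith
  qed
  then show ?thesis
    using assms(1) by (simp add: difference_set_def)
qed

text \<open>Entering the complement means leaving \<open>D\<close>, and both happen equally often,
  so the same \<open>c\<close> serves both sets.\<close>

lemma difference_set_complement_iff:
  assumes "D \<subseteq> E" "finite E"
  shows "difference_set G E \<phi> (card E) (card D) (int (card D) - int c) D \<longleftrightarrow>
    difference_set G E \<phi> (card E) (card (E - D)) (int (card (E - D)) - int c) (E - D)"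
proof -
  have "E - (E - D) = D"
    using assms(1) by blast
  then have "difference_set G E \<phi> (card E) (card (E - D)) (int (card (E - D)) - int c) (E - D) \<longleftrightarrow>
      (\<forall>\<alpha> \<in> carrier G - {\<one>}. card {x \<in> D. \<phi> \<alpha> x \<in> E - D} = c)"
    using difference_set_iff_card_entering[of "E - D" c] assms(2) by simp
  also have "\<dots> \<longleftrightarrow> (\<forall>\<alpha> \<in> carrier G - {\<one>}. card {x \<in> E - D. \<phi> \<alpha> x \<in> D} = c)"
    using card_leaving_eq_card_entering[OF _ assms] by (intro ball_cong) simp_all
  finally show ?thesis
    unfolding difference_set_iff_card_entering[OF assms] by (rule sym)
qed

end

section \<open>Groups of order two and three\<close>

context group
begin

lemma order_2_inv_eq:
  assumes "order G = 2" "s \<in> carrier G" "s \<noteq> \<one>"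
  shows "inv s = s" "carrier G = {\<one>, s}"
proof -
  have "finite (carrier G)"
    using assms(1) by (intro card_ge_0_finite) (simp add: order_def)
  then show "carrier G = {\<one>, s}"
    using card_subset_eq[of "carrier G" "{\<one>, s}"] assms by (auto simp: order_def)
  moreover have "inv s \<in> carrier G" "inv s \<noteq> \<one>"
    using assms(2,3) by auto
  ultimately show "inv s = s"
    by blast
qed

text \<open>If \<open>s\<close> were its own inverse, its square would be trivial; its cube is
  trivial by Lagrange, so \<open>s\<close> itself would be.\<close>

lemma order_3_inv_neq:
  assumes "order G = 3" "s \<in> carrier G" "s \<noteq> \<one>"
  shows "inv s \<noteq> s" "carrier G = {\<one>, s, inv s}"
proof -
  have fin: "finite (carrier G)"
    using assms(1) by (intro card_ge_0_finite) (simp add: order_def)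
  show neq: "inv s \<noteq> s"
  proof
    assume "inv s = s"
    then have "s \<otimes> s = \<one>"
      using assms(2) r_inv by metis
    moreover have "s [^] order G = \<one>"
      using assms(2) by (rule pow_order_eq_1)
    ultimately show False
      using assms by (simp add: numeral_3_eq_3)
  qed
  have "\<one> \<noteq> inv s" "inv s \<in> carrier G"
    using assms(2,3) inv_eq_1_iff[OF assms(2)] inv_closed[OF assms(2)] by metis+
  then have "{\<one>, s, inv s} \<subseteq> carrier G" "card {\<one>, s, inv s} = card (carrier G)"
    using assms neq by (auto simp: order_def card_insert_if)
  then show "carrier G = {\<one>, s, inv s}"
    by (metis card_subset_eq[OF fin])
qed

end

section \<open>Value distribution of the quotient for a two-valued function\<close>

lemma perfect_nonlinear_two_valued_iff:
  fixes G :: "('a, 'm) monoid_scheme" and H :: "('b, 'n) monoid_scheme"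
  assumes "carrier G \<noteq> {\<one>\<^bsub>G\<^esub>}" "group H" "finite (carrier H)"
    and "group_action G X \<phi>" "finite X"
    and h: "h1 \<in> carrier H" "h2 \<in> carrier H" "h1 \<noteq> h2"
    and im: "f ` X = {h1, h2}"
  defines "D \<equiv> f -` {h1} \<inter> X"
  shows "perfect_nonlinear G X \<phi> H f \<longleftrightarrow>
    (order H = 2 \<and> 4 dvd card X \<and>
      (\<forall>\<alpha> \<in> carrier G - {\<one>\<^bsub>G\<^esub>}. card {x \<in> X - D. \<phi> \<alpha> x \<in> D} = card X div 4)) \<or>
    (order H = 3 \<and> 3 dvd card X \<and>
      (\<forall>\<alpha> \<in> carrier G - {\<one>\<^bsub>G\<^esub>}. card {x \<in> X - D. \<phi> \<alpha> x \<in> D} = card X div 3))"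
proof -
  interpret H: group H by fact
  interpret act: group_action G X \<phi> by fact
  interpret G: group G using act.group_hom by (simp add: group_hom_def)
  define s where "s = h1 \<otimes>\<^bsub>H\<^esub> inv\<^bsub>H\<^esub> h2"
  have s: "s \<in> carrier H" "s \<noteq> \<one>\<^bsub>H\<^esub>"
    using h by (auto simp: s_def H.inv_solve_right')
  have inv_s: "inv\<^bsub>H\<^esub> s = h2 \<otimes>\<^bsub>H\<^esub> inv\<^bsub>H\<^esub> h1" "inv\<^bsub>H\<^esub> s \<in> carrier H" "inv\<^bsub>H\<^esub> s \<noteq> \<one>\<^bsub>H\<^esub>"
    using h s(1) H.inv_eq_1_iff[OF s(1)] s(2) by (simp_all add: s_def H.inv_mult_group)
  define m where "m \<alpha> = card {x \<in> X - D. \<phi> \<alpha> x \<in> D}" for \<alpha>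
  define q where "q \<alpha> x = f (\<phi> \<alpha> x) \<otimes>\<^bsub>H\<^esub> inv\<^bsub>H\<^esub> (f x)" for \<alpha> x
  define N where "N \<alpha> \<sigma> = card {x \<in> X. q \<alpha> x = \<sigma>}" for \<alpha> \<sigma>
  have "D \<subseteq> X" by (auto simp: D_def)
  have "X \<noteq> {}" using im by auto
  then have X_pos: "card X > 0" using \<open>finite X\<close> by (simp add: card_gt_0_iff)
  \<comment> \<open>The witness \<beta> keeps the condition over nontrivial elements from being
    vacuous; it bounds the order of \<open>H\<close> and transfers divisibility in both cases
    below.\<close>
  obtain \<beta> where \<beta>: "\<beta> \<in> carrier G - {\<one>\<^bsub>G\<^esub>}"
    using assms(1) G.one_closed by blast
  have PN: "perfect_nonlinear G X \<phi> H f \<longleftrightarrow> order H dvd card X \<and>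
      (\<forall>\<alpha> \<in> carrier G - {\<one>\<^bsub>G\<^esub>}. \<forall>\<sigma> \<in> carrier H. N \<alpha> \<sigma> = card X div order H)"
    by (simp add: perfect_nonlinear_def N_def q_def)
  have closed: "\<phi> \<alpha> x \<in> X" if "\<alpha> \<in> carrier G" "x \<in> X" for \<alpha> x
    using act.surj_prop that by blast
  have q: "q \<alpha> x = (if x \<in> D \<longleftrightarrow> \<phi> \<alpha> x \<in> D then \<one>\<^bsub>H\<^esub> else if x \<in> D then inv\<^bsub>H\<^esub> s else s)"
    if "\<alpha> \<in> carrier G" "x \<in> X" for \<alpha> x
  proof -
    have "f x = (if x \<in> D then h1 else h2)" "f (\<phi> \<alpha> x) = (if \<phi> \<alpha> x \<in> D then h1 else h2)"
      using that closed[OF that] im by (auto simp: D_def)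
    then show ?thesis
      using h inv_s by (auto simp: q_def s_def)
  qed
  have leaving: "card {x \<in> D. \<phi> \<alpha> x \<in> X - D} = m \<alpha>" if "\<alpha> \<in> carrier G" for \<alpha>
    using act.card_leaving_eq_card_entering[OF that \<open>D \<subseteq> X\<close> \<open>finite X\<close>] by (simp add: m_def)
  \<comment> \<open>The additive form avoids truncated subtraction and holds whether or not
    \<open>s\<close> is an involution.\<close>
  have N_one: "N \<alpha> \<one>\<^bsub>H\<^esub> + 2 * m \<alpha> = card X" if \<alpha>: "\<alpha> \<in> carrier G" for \<alpha>
  proof -
    let ?A = "{x \<in> X. q \<alpha> x = \<one>\<^bsub>H\<^esub>}" and ?B = "{x \<in> D. \<phi> \<alpha> x \<in> X - D}"
      and ?C = "{x \<in> X - D. \<phi> \<alpha> x \<in> D}"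
    have U: "X = ?A \<union> (?B \<union> ?C)"
      using q[OF \<alpha>] closed[OF \<alpha>] \<open>D \<subseteq> X\<close> by (auto split: if_splits)
    have disj: "?A \<inter> (?B \<union> ?C) = {}" "?B \<inter> ?C = {}"
      using q[OF \<alpha>] s inv_s \<open>D \<subseteq> X\<close> by auto
    have fin: "finite ?A" "finite ?B" "finite ?C"
      using \<open>finite X\<close> finite_subset[OF \<open>D \<subseteq> X\<close>] by auto
    have "card X = card (?A \<union> (?B \<union> ?C))"
      using U by (rule arg_cong)
    also have "\<dots> = card ?A + card (?B \<union> ?C)"
      using fin disj by (intro card_Un_disjoint) auto
    also have "card (?B \<union> ?C) = card ?B + card ?C"
      using fin disj by (intro card_Un_disjoint) auto
    finally have "card X = card ?A + (card ?B + card ?C)" .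
    then show ?thesis
      using leaving[OF \<alpha>] by (simp add: N_def m_def)
  qed
  have N_s: "N \<alpha> s = m \<alpha>" "N \<alpha> (inv\<^bsub>H\<^esub> s) = m \<alpha>" if \<alpha>: "\<alpha> \<in> carrier G" and neq: "inv\<^bsub>H\<^esub> s \<noteq> s" for \<alpha>
  proof -
    have "q \<alpha> x = s \<longleftrightarrow> x \<notin> D \<and> \<phi> \<alpha> x \<in> D" "q \<alpha> x = inv\<^bsub>H\<^esub> s \<longleftrightarrow> x \<in> D \<and> \<phi> \<alpha> x \<notin> D"
      if "x \<in> X" for x
      using q[OF \<alpha> that] s(2) inv_s(3) neq by metis+
    then have "{x \<in> X. q \<alpha> x = s} = {x \<in> X - D. \<phi> \<alpha> x \<in> D}"
      "{x \<in> X. q \<alpha> x = inv\<^bsub>H\<^esub> s} = {x \<in> D. \<phi> \<alpha> x \<in> X - D}"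
      using closed[OF \<alpha>] \<open>D \<subseteq> X\<close> by blast+
    then show "N \<alpha> s = m \<alpha>" "N \<alpha> (inv\<^bsub>H\<^esub> s) = m \<alpha>"
      using leaving[OF \<alpha>] by (simp_all add: N_def m_def)
  qed
  \<comment> \<open>Here entering and leaving points yield the same value, so their counts add
    up.\<close>
  have N_involution: "N \<alpha> s = 2 * m \<alpha>" if \<alpha>: "\<alpha> \<in> carrier G" and eq: "inv\<^bsub>H\<^esub> s = s" for \<alpha>
  proof -
    have "q \<alpha> x = s \<longleftrightarrow> (x \<in> D \<longleftrightarrow> \<phi> \<alpha> x \<notin> D)" if "x \<in> X" for x
      using q[OF \<alpha> that] s(2) eq by metis
    then have "{x \<in> X. q \<alpha> x = s} = {x \<in> X - D. \<phi> \<alpha> x \<in> D} \<union> {x \<in> D. \<phi> \<alpha> x \<in> X - D}"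
      using closed[OF \<alpha>] \<open>D \<subseteq> X\<close> by blast
    moreover have "finite {x \<in> D. \<phi> \<alpha> x \<in> X - D}"
      using finite_subset[OF \<open>D \<subseteq> X\<close> \<open>finite X\<close>] by simp
    moreover have "finite {x \<in> X - D. \<phi> \<alpha> x \<in> D}"
      using \<open>finite X\<close> by simp
    moreover have "{x \<in> X - D. \<phi> \<alpha> x \<in> D} \<inter> {x \<in> D. \<phi> \<alpha> x \<in> X - D} = {}"
      by auto
    ultimately have "N \<alpha> s = card {x \<in> X - D. \<phi> \<alpha> x \<in> D} + card {x \<in> D. \<phi> \<alpha> x \<in> X - D}"
      by (simp only: N_def card_Un_disjoint)
    then show ?thesis
      using leaving[OF \<alpha>] by (simp add: m_def)
  qed
  have order_cases: "order H = 2 \<or> order H = 3" if pn: "perfect_nonlinear G X \<phi> H f"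
  proof -
    \<comment> \<open>As \<open>X\<close> is nonempty, the common count is positive, so every
      element of \<open>H\<close> must occur as a value.\<close>
    have pos: "card X div order H > 0"
      using pn[unfolded PN] X_pos by (auto elim!: dvdE)
    have "\<sigma> \<in> {\<one>\<^bsub>H\<^esub>, s, inv\<^bsub>H\<^esub> s}" if "\<sigma> \<in> carrier H" for \<sigma>
    proof (rule ccontr)
      assume "\<sigma> \<notin> {\<one>\<^bsub>H\<^esub>, s, inv\<^bsub>H\<^esub> s}"
      then have "{x \<in> X. q \<beta> x = \<sigma>} = {}"
        using q \<beta> by auto
      then have "N \<beta> \<sigma> = 0"
        unfolding N_def by (simp only: card.empty)
      then show False
        using pn[unfolded PN] \<beta> that pos by (metis less_irrefl)
    qed
    then have "carrier H \<subseteq> {\<one>\<^bsub>H\<^esub>, s, inv\<^bsub>H\<^esub> s}" by blast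
    then have "order H \<le> card {\<one>\<^bsub>H\<^esub>, s, inv\<^bsub>H\<^esub> s}"
      unfolding order_def by (intro card_mono) auto
    also have "\<dots> \<le> 3" by (simp add: card_insert_if)
    finally have "order H \<le> 3" .
    \<comment> \<open>Only these two elements are known to be distinct, since \<open>s\<close> may
      equal its inverse.\<close>
    moreover have "card {\<one>\<^bsub>H\<^esub>, s} \<le> order H"
      unfolding order_def using s assms(3) by (intro card_mono) auto
    ultimately show ?thesis
      using s by auto
  qed
  have case2: "perfect_nonlinear G X \<phi> H f \<longleftrightarrow>
      4 dvd card X \<and> (\<forall>\<alpha> \<in> carrier G - {\<one>\<^bsub>G\<^esub>}. m \<alpha> = card X div 4)" if "order H = 2"
  proof -
    note o = H.order_2_inv_eq[OF that s]
    have *: "2 dvd card X \<and> (\<forall>\<sigma> \<in> carrier H. N \<alpha> \<sigma> = card X div 2) \<longleftrightarrow>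
        4 dvd card X \<and> m \<alpha> = card X div 4" if "\<alpha> \<in> carrier G" for \<alpha>
    proof -
      have "2 dvd card X \<and> (\<forall>\<sigma> \<in> carrier H. N \<alpha> \<sigma> = card X div 2) \<longleftrightarrow>
          2 dvd card X \<and> N \<alpha> \<one>\<^bsub>H\<^esub> = card X div 2 \<and> 2 * m \<alpha> = card X div 2"
        unfolding o(2) using N_involution[OF that o(1)] by simp
      \<comment> \<open>One equation captures both counts and the divisibility: by
        \<open>N_one\<close> the identity then occurs \<open>2 * m \<alpha>\<close> times.\<close>
      also have "\<dots> \<longleftrightarrow> card X = 4 * m \<alpha>"
        using N_one[OF that] by (auto elim!: dvdE)
      also have "\<dots> \<longleftrightarrow> 4 dvd card X \<and> m \<alpha> = card X div 4"
        by auto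
      finally show ?thesis .
    qed
    show ?thesis
      unfolding PN \<open>order H = 2\<close> using * \<beta> by blast
  qed
  have case3: "perfect_nonlinear G X \<phi> H f \<longleftrightarrow>
      3 dvd card X \<and> (\<forall>\<alpha> \<in> carrier G - {\<one>\<^bsub>G\<^esub>}. m \<alpha> = card X div 3)" if "order H = 3"
  proof -
    note o = H.order_3_inv_neq[OF that s]
    have *: "3 dvd card X \<and> (\<forall>\<sigma> \<in> carrier H. N \<alpha> \<sigma> = card X div 3) \<longleftrightarrow>
        3 dvd card X \<and> m \<alpha> = card X div 3" if "\<alpha> \<in> carrier G" for \<alpha>
    proof -
      have "3 dvd card X \<and> (\<forall>\<sigma> \<in> carrier H. N \<alpha> \<sigma> = card X div 3) \<longleftrightarrow>
          3 dvd card X \<and> N \<alpha> \<one>\<^bsub>H\<^esub> = card X div 3 \<and> m \<alpha> = card X div 3"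
        unfolding o(2) using N_s[OF that o(1)] by simp
      \<comment> \<open>When \<open>m \<alpha>\<close> is a third of \<open>card X\<close>,
        \<open>N_one\<close> leaves exactly a third for the identity.\<close>
      also have "\<dots> \<longleftrightarrow> 3 dvd card X \<and> m \<alpha> = card X div 3"
        using N_one[OF that] by (auto elim!: dvdE)
      finally show ?thesis .
    qed
    show ?thesis
      unfolding PN \<open>order H = 3\<close> using * \<beta> by blast
  qed
  show ?thesis
    using order_cases case2 case3 unfolding m_def by blast
qed

section \<open>Translation into difference sets and symmetry between the two fibres\<close>

theorem theorem2p11:
  fixes G :: "('a, 'm) monoid_scheme"
    and H :: "('b, 'n) monoid_scheme"
    and X :: "'x set"
    and \<phi> :: "'a \<Rightarrow> 'x \<Rightarrow> 'x"
    and f :: "'x \<Rightarrow> 'b"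
    and h1 h2 :: 'b
    and v k1 k2 :: nat
  assumes "group G" and "finite (carrier G)" and "carrier G \<noteq> {\<one>\<^bsub>G\<^esub>}"
    and "group H" and "finite (carrier H)"
    and "group_action G X \<phi>" and "finite X" and "card X = v"
    and "f \<in> X \<rightarrow> carrier H"
    and "h1 \<in> carrier H" and "h2 \<in> carrier H" and "h1 \<noteq> h2"
    and "f ` X = {h1, h2}"
    and "k1 = card (f -` {h1} \<inter> X)" and "k2 = card (f -` {h2} \<inter> X)"
  shows "(perfect_nonlinear G X \<phi> H f \<longleftrightarrow>
            (order H = 2 \<and> 4 dvd v \<and>
               difference_set G X \<phi> v k1 (int k1 - int (v div 4)) (f -` {h1} \<inter> X)) \<or>
            (order H = 3 \<and> 3 dvd v \<and>
               difference_set G X \<phi> v k1 (int k1 - int (v div 3)) (f -` {h1} \<inter> X)))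
       \<and> (order H = 2 \<and> 4 dvd v \<longrightarrow>
            (difference_set G X \<phi> v k1 (int k1 - int (v div 4)) (f -` {h1} \<inter> X) \<longleftrightarrow>
             difference_set G X \<phi> v k2 (int k2 - int (v div 4)) (f -` {h2} \<inter> X)))
       \<and> (order H = 3 \<and> 3 dvd v \<longrightarrow>
            (difference_set G X \<phi> v k1 (int k1 - int (v div 3)) (f -` {h1} \<inter> X) \<longleftrightarrow>
             difference_set G X \<phi> v k2 (int k2 - int (v div 3)) (f -` {h2} \<inter> X)))"
proof -
  interpret act: group_action G X \<phi> by fact
  let ?D = "f -` {h1} \<inter> X"
  have sub: "?D \<subseteq> X" by auto
  have co: "f -` {h2} \<inter> X = X - ?D"
    using \<open>f ` X = {h1, h2}\<close> \<open>h1 \<noteq> h2\<close> by auto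
  \<comment> \<open>The two fibres are complementary, so this is the complement lemma. It is stated
    for all \<open>c\<close> to cover \<open>v div 4\<close> and \<open>v div 3\<close>, which are
    exact quotients under the divisibility conditions.\<close>
  have swap: "difference_set G X \<phi> v k1 (int k1 - int c) ?D \<longleftrightarrow>
      difference_set G X \<phi> v k2 (int k2 - int c) (f -` {h2} \<inter> X)" for c
    using act.difference_set_complement_iff[OF sub \<open>finite X\<close>, of c]
      \<open>k1 = _\<close> \<open>k2 = _\<close> \<open>card X = v\<close> unfolding co by simp
  have entering: "difference_set G X \<phi> v k1 (int k1 - int c) ?D \<longleftrightarrow>
      (\<forall>\<alpha> \<in> carrier G - {\<one>\<^bsub>G\<^esub>}. card {x \<in> X - ?D. \<phi> \<alpha> x \<in> ?D} = c)" for c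
    using act.difference_set_iff_card_entering[OF sub \<open>finite X\<close>, of c]
      \<open>k1 = _\<close> \<open>card X = v\<close> by simp
  have "perfect_nonlinear G X \<phi> H f \<longleftrightarrow>
      (order H = 2 \<and> 4 dvd v \<and> difference_set G X \<phi> v k1 (int k1 - int (v div 4)) ?D) \<or>
      (order H = 3 \<and> 3 dvd v \<and> difference_set G X \<phi> v k1 (int k1 - int (v div 3)) ?D)"
    using perfect_nonlinear_two_valued_iff[of G H X \<phi> h1 h2 f] assms
    unfolding entering by simp
  then show ?thesis
    using swap by blast
qed

end
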